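(* Let $A_2$ be the 2-state Mealy automaton over the 4-symbol alphabet $\{x_0,x_1,x_2,x_3\}$ whose automatic transformations have the unrolled forms $$f_0=(f_0,f_0,f_0,f_0)(x_1,x_1,x_0,x_0),\qquad f_1=(f_0,f_1,f_1,f_1)(x_0,x_2,x_0,x_1).$$ Then: (1) The semigroup $S_{A_2}$ generated by $f_0,f_1$ has the semigroup presentation with generators $f_0,f_1$ and defining relations $$f_0^2f_i=f_0f_1^2f_i=f_0^2\ (i=0,1),\qquad f_1^2f_0^2=f_0f_1f_0^2,$$ $$f_1f_0f_1f_0^2=f_1^4=f_1^3f_0,\qquad (f_1f_0)^4=(f_1f_0)^2 .$$ (2) The growth function $\gamma_{A_2}$ of $A_2$ is a composite function for $k=2$, given by $$\gamma_{A_2}(2n)=8,\qquad \gamma_{A_2}(2n+1)=9\qquad\text{for all } n\ge 2,$$ and $\gamma_{A_2}(1)=2$, $\gamma_{A_2}(2)=4$, $\gamma_{A_2}(3)=7$.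
   Context: A Mealy automaton with states $q_0,\dots,q_{n-1}$ and input/output alphabet $X_m=\{x_0,\dots,x_{m-1}\}$ has a transition function $\pi:X_m\times Q\to Q$ and an output function $\lambda:X_m\times Q\to X_m$. The state $q_i$ defines an automatic transformation $f_i=f_{q_i}$ of the set of finite (or infinite) words over $X_m$: on input $x u$ ($x$ a letter) it outputs $\lambda(x,q_i)$ followed by $f_{\pi(x,q_i)}(u)$. The unrolled form $f_i=(g_0,\dots,g_{m-1})(y_0,\dots,y_{m-1})$ means $f_i(x_ju)=y_j\,g_j(u)$ for every letter $x_j$ and word $u$. Products of transformations are compositions applied from right to left: $(fg)(u)=f(g(u))$. $S_A$ is the semigroup generated by the automatic transformations $f_0,\dots,f_{n-1}$ under composition. The growth function of $A$ is $\gamma_A(n)=|Q_{A^{(n)}}|$, the number of states of the minimal automaton equivalent to the $n$-th power $A^n$ (sequential application); equivalently, for $n\ge1$, $\gamma_A(n)$ is the number of distinct transformations of the form $f_{i_1}f_{i_2}\cdots f_{i_n}$ (products of exactly $n$ generators). A function $\gamma$ is called composite for $k\geq 2$ if at least two of the functions $n\mapsto\gamma(kn+i)$, $0\le i<k$, are given by different expressions; for $k=2$ here this is witnessed by the two displayed formulas for even and odd arguments. *)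

theory Defs
  imports Main
begin

section \<open>Mealy automata and automatic transformations\<close>

text \<open>The input/output alphabet is the type \<open>'x\<close>, so a word is just a list over \<open>'x\<close>.\<close>

record ('q, 'x) mealy =
  states :: "'q set"
  trans :: "'x \<Rightarrow> 'q \<Rightarrow> 'q"
  out :: "'x \<Rightarrow> 'q \<Rightarrow> 'x"

definition mealy_automaton :: "('q, 'x::finite) mealy \<Rightarrow> bool" where
  "mealy_automaton A \<longleftrightarrow>
     finite (states A) \<and> states A \<noteq> {} \<and> (\<forall>x. \<forall>q\<in>states A. trans A x q \<in> states A)"

primrec transformation :: "('q, 'x) mealy \<Rightarrow> 'q \<Rightarrow> 'x list \<Rightarrow> 'x list" where
  "transformation A q [] = []"
| "transformation A q (x # u) = out A x q # transformation A (trans A x q) u"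

definition transformations :: "('q, 'x) mealy \<Rightarrow> ('x list \<Rightarrow> 'x list) set" where
  "transformations A = transformation A ` states A"

inductive_set generated_semigroup :: "('a \<Rightarrow> 'a) set \<Rightarrow> ('a \<Rightarrow> 'a) set"
  for F :: "('a \<Rightarrow> 'a) set" where
  gen: "f \<in> F \<Longrightarrow> f \<in> generated_semigroup F"
| comp: "f \<in> generated_semigroup F \<Longrightarrow> g \<in> generated_semigroup F \<Longrightarrow>
           f \<circ> g \<in> generated_semigroup F"

definition automaton_semigroup :: "('q, 'x) mealy \<Rightarrow> ('x list \<Rightarrow> 'x list) set" where
  "automaton_semigroup A = generated_semigroup (transformations A)"

section \<open>Growth function\<close>

text \<open>
  The states of the \<open>n\<close>-th power of \<open>A\<close> are the lists \<open>[q\<^sub>1, \<dots>, q\<^sub>n]\<close> of states of \<open>A\<close>. Since products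
  act from right to left, the input letter is fed to \<open>q\<^sub>n\<close> first; the output letter of each
  component is the input letter of the component to its left, and the final output is that of \<open>q\<^sub>1\<close>.
\<close>

primrec power_out :: "('q, 'x) mealy \<Rightarrow> 'x \<Rightarrow> 'q list \<Rightarrow> 'x" where
  "power_out A x [] = x"
| "power_out A x (q # qs) = out A (power_out A x qs) q"

primrec power_trans :: "('q, 'x) mealy \<Rightarrow> 'x \<Rightarrow> 'q list \<Rightarrow> 'q list" where
  "power_trans A x [] = []"
| "power_trans A x (q # qs) = trans A (power_out A x qs) q # power_trans A x qs"

definition mealy_power :: "('q, 'x) mealy \<Rightarrow> nat \<Rightarrow> ('q list, 'x) mealy" where
  "mealy_power A n =
     \<lparr>states = {qs. set qs \<subseteq> states A \<and> length qs = n},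
      trans = power_trans A, out = power_out A\<rparr>"

definition equivalent_automata :: "('p, 'x) mealy \<Rightarrow> ('q, 'x) mealy \<Rightarrow> bool" where
  "equivalent_automata A B \<longleftrightarrow> transformations A = transformations B"

text \<open>
  The number of states of the minimal automaton equivalent to \<open>A\<close>. Every finite automaton is
  isomorphic to one whose states are natural numbers, so ranging over those loses nothing.
\<close>

definition minimal_size :: "('q, 'x::finite) mealy \<Rightarrow> nat" where
  "minimal_size A =
     (LEAST k. \<exists>B :: (nat, 'x) mealy.
        mealy_automaton B \<and> equivalent_automata B A \<and> card (states B) = k)"

definition growth :: "('q, 'x::finite) mealy \<Rightarrow> nat \<Rightarrow> nat" where
  "growth A n = minimal_size (mealy_power A n)"

text \<open>
  Two subsequences count as being given by different expressions if they differ at infinitely many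
  arguments; a discrepancy among finitely many initial values is not enough.
\<close>

definition composite_function :: "nat \<Rightarrow> (nat \<Rightarrow> nat) \<Rightarrow> bool" where
  "composite_function k \<gamma> \<longleftrightarrow>
     k \<ge> 2 \<and> (\<exists>i<k. \<exists>j<k. infinite {n. \<gamma> (k * n + i) \<noteq> \<gamma> (k * n + j)})"

section \<open>Semigroup presentations\<close>

definition free_semigroup :: "'g set \<Rightarrow> 'g list set" where
  "free_semigroup G = {w. w \<noteq> [] \<and> set w \<subseteq> G}"

text \<open>The smallest congruence on the free semigroup over \<open>G\<close> that contains \<open>R\<close>.\<close>

inductive_set generated_congruence :: "'g set \<Rightarrow> ('g list \<times> 'g list) set \<Rightarrow> ('g list \<times> 'g list) set"
  for G :: "'g set" and R :: "('g list \<times> 'g list) set" where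
  base: "(u, v) \<in> R \<Longrightarrow> (u, v) \<in> generated_congruence G R"
| refl: "w \<in> free_semigroup G \<Longrightarrow> (w, w) \<in> generated_congruence G R"
| sym: "(u, v) \<in> generated_congruence G R \<Longrightarrow> (v, u) \<in> generated_congruence G R"
| trans: "(u, v) \<in> generated_congruence G R \<Longrightarrow> (v, w) \<in> generated_congruence G R \<Longrightarrow>
            (u, w) \<in> generated_congruence G R"
| mult: "(u, v) \<in> generated_congruence G R \<Longrightarrow> (u', v') \<in> generated_congruence G R \<Longrightarrow>
            (u @ u', v @ v') \<in> generated_congruence G R"

text \<open>
  The set \<open>S\<close> with the multiplication \<open>mul\<close> has the presentation \<open>\<langle>G | R\<rangle>\<close>, the symbol \<open>g \<in> G\<close>
  standing for the element \<open>\<phi> g\<close>: there is an isomorphism \<open>h\<close> from the quotient of the free semigroup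
  by the congruence generated by \<open>R\<close> onto \<open>S\<close> that sends the class of \<open>g\<close> to \<open>\<phi> g\<close>.
\<close>

definition has_presentation ::
  "'s set \<Rightarrow> ('s \<Rightarrow> 's \<Rightarrow> 's) \<Rightarrow> ('g \<Rightarrow> 's) \<Rightarrow> 'g set \<Rightarrow> ('g list \<times> 'g list) set \<Rightarrow> bool" where
  "has_presentation S mul \<phi> G R \<longleftrightarrow>
     R \<subseteq> free_semigroup G \<times> free_semigroup G \<and>
     (\<exists>h. bij_betw h (free_semigroup G // generated_congruence G R) S \<and>
          (\<forall>g\<in>G. h (generated_congruence G R `` {[g]}) = \<phi> g) \<and>
          (\<forall>u\<in>free_semigroup G. \<forall>v\<in>free_semigroup G.
             h (generated_congruence G R `` {u @ v}) =
             mul (h (generated_congruence G R `` {u})) (h (generated_congruence G R `` {v}))))"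

section \<open>The automaton \<open>A\<^sub>2\<close>\<close>

datatype letter = X0 | X1 | X2 | X3

datatype state = F0 | F1

instance letter :: finite
proof
  have "UNIV \<subseteq> {X0, X1, X2, X3}"
    using letter.exhaust by auto
  then show "finite (UNIV :: letter set)"
    by (rule finite_subset) simp
qed

fun A2_trans :: "letter \<Rightarrow> state \<Rightarrow> state" where
  "A2_trans x F0 = F0"
| "A2_trans X0 F1 = F0"
| "A2_trans X1 F1 = F1"
| "A2_trans X2 F1 = F1"
| "A2_trans X3 F1 = F1"

fun A2_out :: "letter \<Rightarrow> state \<Rightarrow> letter" where
  "A2_out X0 F0 = X1"
| "A2_out X1 F0 = X1"
| "A2_out X2 F0 = X0"
| "A2_out X3 F0 = X0"
| "A2_out X0 F1 = X0"
| "A2_out X1 F1 = X2"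
| "A2_out X2 F1 = X0"
| "A2_out X3 F1 = X1"

definition A2 :: "(state, letter) mealy" where
  "A2 = \<lparr>states = {F0, F1}, trans = A2_trans, out = A2_out\<rparr>"

text \<open>The unrolled forms \<open>f\<^sub>0 = (f\<^sub>0, f\<^sub>0, f\<^sub>0, f\<^sub>0)(x\<^sub>1, x\<^sub>1, x\<^sub>0, x\<^sub>0)\<close> and
  \<open>f\<^sub>1 = (f\<^sub>0, f\<^sub>1, f\<^sub>1, f\<^sub>1)(x\<^sub>0, x\<^sub>2, x\<^sub>0, x\<^sub>1)\<close>:\<close>

lemma A2_unrolled:
  "transformation A2 F0 (X0 # u) = X1 # transformation A2 F0 u"
  "transformation A2 F0 (X1 # u) = X1 # transformation A2 F0 u"
  "transformation A2 F0 (X2 # u) = X0 # transformation A2 F0 u"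
  "transformation A2 F0 (X3 # u) = X0 # transformation A2 F0 u"
  "transformation A2 F1 (X0 # u) = X0 # transformation A2 F0 u"
  "transformation A2 F1 (X1 # u) = X2 # transformation A2 F1 u"
  "transformation A2 F1 (X2 # u) = X0 # transformation A2 F1 u"
  "transformation A2 F1 (X3 # u) = X1 # transformation A2 F1 u"
  by (simp_all add: A2_def)

definition A2_relations :: "(state list \<times> state list) set" where
  "A2_relations =
     (\<Union>i\<in>{F0, F1}. {([F0, F0, i], [F0, F1, F1, i]), ([F0, F1, F1, i], [F0, F0])}) \<union>
     {([F1, F1, F0, F0], [F0, F1, F0, F0]),
      ([F1, F0, F1, F0, F0], [F1, F1, F1, F1]),
      ([F1, F1, F1, F1], [F1, F1, F1, F0]),
      ([F1, F0, F1, F0, F1, F0, F1, F0], [F1, F0, F1, F0])}"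

end

theory Submission
  imports Defs
begin

text \<open>
  Oriented from left to right and completed by \<open>1110x \<rightarrow> 1110\<close>, the defining relations rewrite every
  word to one of 37 normal forms, and four input words suffice to separate the transformations of
  these normal forms. Hence the relations present the semigroup, which is finite, and the growth
  function counts the normal forms of the words of length \<open>n\<close>. The set of these is computed from the
  one for \<open>n - 1\<close> by left multiplication with the generators and is periodic with period 4 from
  \<open>n = 6\<close> on.
\<close>

section \<open>Presentations of transformation semigroups\<close>

definition word_map :: "('g \<Rightarrow> 'a \<Rightarrow> 'a) \<Rightarrow> 'g list \<Rightarrow> 'a \<Rightarrow> 'a" where
  "word_map \<phi> w = foldr (\<lambda>g f. \<phi> g \<circ> f) w id"

lemma word_map_simps [simp]:
  "word_map \<phi> [] = id"
  "word_map \<phi> (g # w) = \<phi> g \<circ> word_map \<phi> w"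
  by (simp_all add: word_map_def)

lemma word_map_append [simp]: "word_map \<phi> (u @ v) = word_map \<phi> u \<circ> word_map \<phi> v"
  by (induction u) (simp_all add: comp_assoc)

lemma free_semigroup_append:
  "u \<in> free_semigroup G \<Longrightarrow> v \<in> free_semigroup G \<Longrightarrow> u @ v \<in> free_semigroup G"
  by (simp add: free_semigroup_def)

lemma generated_semigroup_eq_word_map:
  "generated_semigroup (\<phi> ` G) = word_map \<phi> ` free_semigroup G"
proof (intro equalityI subsetI)
  fix f assume "f \<in> generated_semigroup (\<phi> ` G)"
  then show "f \<in> word_map \<phi> ` free_semigroup G"
  proof induction
    case (gen f)
    then obtain g where "g \<in> G" "f = \<phi> g" by blast
    then have "[g] \<in> free_semigroup G" "f = word_map \<phi> [g]"
      by (simp_all add: free_semigroup_def)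
    then show ?case by blast
  next
    case (comp f g)
    then obtain u v where "u \<in> free_semigroup G" "f = word_map \<phi> u"
      and "v \<in> free_semigroup G" "g = word_map \<phi> v" by blast
    then have "u @ v \<in> free_semigroup G" "f \<circ> g = word_map \<phi> (u @ v)"
      by (simp_all add: free_semigroup_append)
    then show ?case by blast
  qed
next
  have "w \<noteq> [] \<Longrightarrow> set w \<subseteq> G \<Longrightarrow> word_map \<phi> w \<in> generated_semigroup (\<phi> ` G)" for w
  proof (induction w rule: list_nonempty_induct)
    case (single g)
    then show ?case by (auto intro: generated_semigroup.gen)
  next
    case (cons g w)
    then have "\<phi> g \<in> generated_semigroup (\<phi> ` G)"
      by (auto intro: generated_semigroup.gen)
    moreover have "word_map \<phi> w \<in> generated_semigroup (\<phi> ` G)"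
      using cons by simp
    ultimately show ?case
      unfolding word_map_simps by (rule generated_semigroup.comp)
  qed
  then show "f \<in> generated_semigroup (\<phi> ` G)" if "f \<in> word_map \<phi> ` free_semigroup G" for f
    using that by (auto simp: free_semigroup_def)
qed

lemma generated_congruence_subset:
  assumes "R \<subseteq> free_semigroup G \<times> free_semigroup G"
  shows "(u, v) \<in> generated_congruence G R \<Longrightarrow> u \<in> free_semigroup G \<and> v \<in> free_semigroup G"
  by (induction rule: generated_congruence.induct) (use assms free_semigroup_append in blast)+

lemma word_map_eq_if_congruent:
  assumes "\<And>u v. (u, v) \<in> R \<Longrightarrow> word_map \<phi> u = word_map \<phi> v"
  shows "(u, v) \<in> generated_congruence G R \<Longrightarrow> word_map \<phi> u = word_map \<phi> v"
  by (induction rule: generated_congruence.induct) (use assms in auto)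

text \<open>First isomorphism theorem: if the relations generate exactly the kernel of
  \<open>word_map\<close>, evaluating a representative of each class is an isomorphism.\<close>

lemma has_presentation_word_map:
  assumes R: "R \<subseteq> free_semigroup G \<times> free_semigroup G"
    and kernel: "\<And>u v. u \<in> free_semigroup G \<Longrightarrow> v \<in> free_semigroup G \<Longrightarrow>
      (u, v) \<in> generated_congruence G R \<longleftrightarrow> word_map \<phi> u = word_map \<phi> v"
  shows "has_presentation (generated_semigroup (\<phi> ` G)) (\<circ>) \<phi> G R"
proof -
  let ?F = "free_semigroup G" and ?C = "generated_congruence G R"
  define h where "h X = word_map \<phi> (SOME u. u \<in> X)" for X
  \<comment> \<open>Each class is a full fibre of \<open>word_map\<close>, so the choice in
    \<open>h\<close> does not affect its value.\<close>
  have cls: "?C `` {u} = {v \<in> ?F. word_map \<phi> v = word_map \<phi> u}" if "u \<in> ?F" for u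
    using kernel[OF that] generated_congruence_subset[OF R] by fastforce
  have h: "h (?C `` {u}) = word_map \<phi> u" if "u \<in> ?F" for u
  proof -
    have "u \<in> ?C `` {u}" using cls[OF that] that by simp
    then have "(SOME v. v \<in> ?C `` {u}) \<in> ?C `` {u}" by (rule someI)
    then show ?thesis unfolding h_def using cls[OF that] by simp
  qed
  have "bij_betw h (?F // ?C) (generated_semigroup (\<phi> ` G))"
    unfolding bij_betw_def generated_semigroup_eq_word_map
  proof
    show "inj_on h (?F // ?C)"
    proof (rule inj_onI)
      fix X Y assume "X \<in> ?F // ?C" "Y \<in> ?F // ?C" "h X = h Y"
      then show "X = Y"
        by (elim quotientE) (simp add: h, simp add: cls)
    qed
    show "h ` (?F // ?C) = word_map \<phi> ` ?F"
      by (auto simp: quotient_def h image_UN)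
  qed
  moreover have "h (?C `` {[g]}) = \<phi> g" if "g \<in> G" for g
    using that by (simp add: h free_semigroup_def)
  moreover have "h (?C `` {u @ v}) = h (?C `` {u}) \<circ> h (?C `` {v})" if "u \<in> ?F" "v \<in> ?F" for u v
    using that by (simp add: h free_semigroup_append)
  ultimately show ?thesis
    unfolding has_presentation_def using R by blast
qed

section \<open>Growth as a count of transformations\<close>

text \<open>This makes equality of transformations compatible with outputs and transitions, so that
  states can be merged along it.\<close>

lemma transformation_inject:
  assumes "transformation A p = transformation A q"
  shows "out A x p = out A x q"
    and "transformation A (trans A x p) = transformation A (trans A x q)"
proof -
  have "transformation A p (x # u) = transformation A q (x # u)" for u
    using assms by simp
  then show "out A x p = out A x q"
    and "transformation A (trans A x p) = transformation A (trans A x q)"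
    by (simp_all add: fun_eq_iff)
qed

text \<open>An equivalent automaton needs at least one state per transformation; merging the states
  of \<open>A\<close> with equal transformations attains this bound.\<close>

lemma minimal_size_eq_card_transformations:
  assumes A: "mealy_automaton A"
  shows "minimal_size A = card (transformations A)"
  unfolding minimal_size_def
proof (rule Least_equality)
  let ?T = "transformations A" and ?tr = "transformation A"
  have "finite ?T"
    using A by (simp add: mealy_automaton_def transformations_def)
  then obtain e where "bij_betw e ?T {0..<card ?T}"
    using ex_bij_betw_finite_nat by blast
  then have e: "inj_on e ?T" and range: "e ` ?T = {0..<card ?T}"
    by (auto simp: bij_betw_def)
  \<comment> \<open>\<open>e\<close> numbers the transformations; \<open>r\<close> picks one state
    of \<open>A\<close> for each number in use.\<close>
  define r where "r i = (SOME q. q \<in> states A \<and> e (?tr q) = i)" for i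
  have r: "r i \<in> states A \<and> e (?tr (r i)) = i" if "i \<in> e ` ?T" for i
    unfolding r_def by (rule someI_ex) (use that in \<open>auto simp: transformations_def\<close>)
  have trans: "trans A x q \<in> states A" if "q \<in> states A" for x q
    using A that by (simp add: mealy_automaton_def)
  have r_tr: "?tr (r (e (?tr q))) = ?tr q" if "q \<in> states A" for q
  proof -
    have T: "?tr q \<in> ?T" using that by (simp add: transformations_def)
    then have "r (e (?tr q)) \<in> states A" "e (?tr (r (e (?tr q)))) = e (?tr q)"
      using r by blast+
    then show ?thesis
      using T inj_onD[OF e] by (simp add: transformations_def)
  qed
  define B where "B = \<lparr>states = e ` ?T, trans = \<lambda>x i. e (?tr (trans A x (r i))),
    out = \<lambda>x i. out A x (r i)\<rparr>"
  have B: "transformation B (e (?tr q)) u = ?tr q u" if "q \<in> states A" for q u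
    using that
  proof (induction u arbitrary: q)
    case Nil
    then show ?case by simp
  next
    case (Cons x u)
    \<comment> \<open>\<open>B\<close> acts through the representative of \<open>q\<close>, whose
      outputs and whose successors' transformations agree with those of \<open>q\<close>.\<close>
    note [simp] = transformation_inject[OF r_tr[OF Cons.prems]]
    show ?case
      using Cons.IH[OF trans[OF Cons.prems]] by (simp add: B_def)
  qed
  have "transformations B = (\<lambda>q. transformation B (e (?tr q))) ` states A"
    by (simp add: transformations_def B_def image_image)
  also have "\<dots> = ?T"
    unfolding transformations_def by (rule image_cong) (simp_all add: B fun_eq_iff)
  finally have "equivalent_automata B A"
    by (simp add: equivalent_automata_def)
  moreover have "mealy_automaton B"
    using A \<open>finite ?T\<close> r trans by (auto simp: mealy_automaton_def B_def transformations_def)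
  moreover have "card (states B) = card ?T"
    by (simp add: B_def range)
  ultimately show "\<exists>B :: (nat, 'b) mealy.
      mealy_automaton B \<and> equivalent_automata B A \<and> card (states B) = card ?T"
    by blast
next
  fix k
  assume "\<exists>B :: (nat, 'b) mealy. mealy_automaton B \<and> equivalent_automata B A \<and> card (states B) = k"
  then obtain B :: "(nat, 'b) mealy" where "finite (states B)" "card (states B) = k"
    and "transformations A = transformations B"
    by (auto simp: mealy_automaton_def equivalent_automata_def)
  then show "card (transformations A) \<le> k"
    by (auto simp: transformations_def card_image_le)
qed

section \<open>Powers of an automaton\<close>

lemma transformation_mealy_power:
  "transformation (mealy_power A n) qs = word_map (transformation A) qs"
proof -
  \<comment> \<open>The head \<open>q\<close> reads the output of the tail \<open>qs\<close>. Only
    the state set of the power depends on \<open>n\<close>, so the lists may have any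
    length.\<close>
  have step: "transformation (mealy_power A n) (q # qs) u =
      transformation A q (transformation (mealy_power A n) qs u)" for q qs u
    by (induction u arbitrary: q qs) (simp_all add: mealy_power_def)
  have "transformation (mealy_power A n) [] u = u" for u
    by (induction u) (simp_all add: mealy_power_def)
  then show ?thesis
    by (induction qs) (simp_all add: fun_eq_iff step)
qed

lemma set_power_trans:
  assumes "mealy_automaton A" "set qs \<subseteq> states A"
  shows "set (power_trans A x qs) \<subseteq> states A"
  using assms(2) by (induction qs) (use assms(1) in \<open>auto simp: mealy_automaton_def\<close>)

lemma length_power_trans [simp]: "length (power_trans A x qs) = length qs"
  by (induction qs) simp_all

lemma length_transformation [simp]: "length (transformation A q u) = length u"
  by (induction u arbitrary: q) simp_all

lemma mealy_automaton_power:
  assumes "mealy_automaton A"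
  shows "mealy_automaton (mealy_power A n)"
proof -
  obtain q where "q \<in> states A"
    using assms by (auto simp: mealy_automaton_def)
  then have "replicate n q \<in> states (mealy_power A n)"
    by (auto simp: mealy_power_def)
  moreover have "finite (states (mealy_power A n))"
    using assms by (simp add: mealy_power_def mealy_automaton_def finite_lists_length_eq)
  ultimately show ?thesis
    using set_power_trans[OF assms]
    unfolding mealy_automaton_def by (auto simp: mealy_power_def)
qed

lemma growth_eq_card_word_map:
  assumes "mealy_automaton A"
  shows "growth A n =
    card (word_map (transformation A) ` {qs. set qs \<subseteq> states A \<and> length qs = n})"
  using minimal_size_eq_card_transformations[OF mealy_automaton_power[OF assms]]
  \<comment> \<open>\<open>mealy_power\<close> stays folded until its transformations have been
    rewritten to \<open>word_map\<close>.\<close>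
  by (simp add: growth_def transformations_def transformation_mealy_power)
    (simp add: mealy_power_def)

section \<open>The relations hold in the semigroup\<close>

abbreviation ev :: "state list \<Rightarrow> letter list \<Rightarrow> letter list" where
  "ev \<equiv> word_map (transformation A2)"

declare A2_unrolled [simp] transformation.simps(2) [simp del]

text \<open>\<open>F0\<close> is never left, and it outputs only \<open>X0\<close> or
  \<open>X1\<close>, both of which it sends to \<open>X1\<close>.\<close>

lemma f0_f0 [simp]:
  "transformation A2 F0 (transformation A2 F0 u) = replicate (length u) X1"
proof (induction u)
  case (Cons x u)
  then show ?case by (cases x) simp_all
qed simp

lemma f0_replicate [simp]:
  "transformation A2 F0 (replicate n X0) = replicate n X1"
  "transformation A2 F0 (replicate n X1) = replicate n X1"
  "transformation A2 F0 (replicate n X2) = replicate n X0"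
  by (induction n) simp_all

lemma f1_replicate [simp]:
  "transformation A2 F1 (replicate n X1) = replicate n X2"
  "transformation A2 F1 (replicate n X2) = replicate n X0"
  by (induction n) simp_all

text \<open>Reading a letter either keeps the product or turns it into one whose two leftmost
  factors are f0, which is constant by \<open>f0_f0\<close>. The same holds for f0 f1 f1 f1
  below.\<close>

lemma f0_f1_f1_f0 [simp]:
  "transformation A2 F0 (transformation A2 F1 (transformation A2 F1 (transformation A2 F0 u))) =
    replicate (length u) X1"
proof (induction u)
  case (Cons x u)
  then show ?case by (cases x) simp_all
qed simp

lemma f0_f1_f1_f1 [simp]:
  "transformation A2 F0 (transformation A2 F1 (transformation A2 F1 (transformation A2 F1 u))) =
    replicate (length u) X1"
proof (induction u)
  case (Cons x u)
  then show ?case by (cases x) simp_all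
qed simp

lemma ev_f0_f0_right: "ev [F0, F0, x] = ev [F0, F0]"
  by (cases x) (simp_all add: fun_eq_iff)

text \<open>Both products send a nonempty word to \<open>X0\<close> followed only by
  \<open>X1\<close>: whatever the first letter is, the remaining product is constant by the rules
  above. \<open>[F1, F0, F1, F0, F0]\<close> below acts in the same way.\<close>

lemma ev_f1_f1_f1_f1: "ev [F1, F1, F1, F1] = ev [F1, F1, F1, F0]"
proof
  show "ev [F1, F1, F1, F1] u = ev [F1, F1, F1, F0] u" for u
  proof (cases u)
    case (Cons x v)
    then show ?thesis by (cases x) simp_all
  qed simp
qed

lemma ev_f1_f0_f1_f0_f0: "ev [F1, F0, F1, F0, F0] = ev [F1, F1, F1, F1]"
proof
  show "ev [F1, F0, F1, F0, F0] u = ev [F1, F1, F1, F1] u" for u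
  proof (cases u)
    case (Cons x v)
    then show ?thesis by (cases x) simp_all
  qed simp
qed

text \<open>After one letter both sides contain f0 f0 and continue with the same constant word, all
  \<open>X1\<close> or all \<open>X2\<close>.\<close>

lemma ev_f1_f0_power: "ev [F1, F0, F1, F0, F1, F0, F1, F0] = ev [F1, F0, F1, F0]"
proof
  show "ev [F1, F0, F1, F0, F1, F0, F1, F0] u = ev [F1, F0, F1, F0] u" for u
  proof (induction u)
    case (Cons x v)
    then show ?case by (cases x) simp_all
  qed simp
qed

lemma ev_relations: "(u, v) \<in> A2_relations \<Longrightarrow> ev u = ev v"
  unfolding A2_relations_def
  using ev_f0_f0_right ev_f1_f1_f1_f1 ev_f1_f0_f1_f0_f0 ev_f1_f0_power
  by (auto simp: fun_eq_iff)

section \<open>Normal forms\<close>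

abbreviation words :: "state list set" where
  "words \<equiv> free_semigroup {F0, F1}"

abbreviation cong :: "(state list \<times> state list) set" where
  "cong \<equiv> generated_congruence {F0, F1} A2_relations"

lemma in_words_iff [simp]: "w \<in> words \<longleftrightarrow> w \<noteq> []"
  using state.exhaust by (auto simp: free_semigroup_def)

lemma A2_relations_words: "A2_relations \<subseteq> words \<times> words"
  by (auto simp: A2_relations_def)

lemma cong_append_left: "(u, v) \<in> cong \<Longrightarrow> (w @ u, w @ v) \<in> cong"
  \<comment> \<open>\<open>[]\<close> is outside the free semigroup, so \<open>refl\<close> and
    \<open>mult\<close> do not cover it.\<close>
  by (cases "w = []") (simp_all add: generated_congruence.mult generated_congruence.refl)

lemma cong_append_right: "(u, v) \<in> cong \<Longrightarrow> (u @ w, v @ w) \<in> cong"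
  by (cases "w = []") (simp_all add: generated_congruence.mult generated_congruence.refl)

lemmas [trans] = generated_congruence.trans

section \<open>Consequences of the defining relations\<close>

lemma cong_relations:
  "([F0, F0, i], [F0, F1, F1, i]) \<in> cong"
  "([F0, F1, F1, i], [F0, F0]) \<in> cong"
  "([F1, F1, F0, F0], [F0, F1, F0, F0]) \<in> cong"
  "([F1, F0, F1, F0, F0], [F1, F1, F1, F1]) \<in> cong"
  "([F1, F1, F1, F1], [F1, F1, F1, F0]) \<in> cong"
  "([F1, F0, F1, F0, F1, F0, F1, F0], [F1, F0, F1, F0]) \<in> cong"
  by (rule generated_congruence.base; cases i; simp add: A2_relations_def)+

text \<open>The right-hand sides of these rules are left zeros up to congruence, so a rule may discard
  everything to the right of the factor it matches.\<close>

definition zero_rules :: "(state list \<times> state list) list" where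
  "zero_rules =
    [([F0, F0], [F0, F0]), ([F0, F1, F1, F0], [F0, F0]), ([F0, F1, F1, F1], [F0, F0]),
     ([F1, F1, F0, F0], [F0, F1, F0, F0]), ([F1, F0, F1, F0, F0], [F1, F1, F1, F0]),
     ([F1, F1, F1, F1], [F1, F1, F1, F0]), ([F1, F1, F1, F0], [F1, F1, F1, F0])]"

lemma cong_zero:
  assumes "\<And>x. (r @ [x], r) \<in> cong" "r \<noteq> []"
  shows "(r @ t, r) \<in> cong"
proof (induction t)
  case Nil
  then show ?case using assms(2) by (simp add: generated_congruence.refl)
next
  case (Cons x t)
  have "(r @ x # t, r @ t) \<in> cong"
    using cong_append_right[OF assms(1)[of x], of t] by simp
  then show ?case using Cons by (rule generated_congruence.trans)
qed

lemma cong_f0_f0_zero: "([F0, F0, x], [F0, F0]) \<in> cong"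
  by (rule generated_congruence.trans) (rule cong_relations)+

text \<open>This is the completing rule. For \<open>F0\<close>, rewriting the suffix 1100 of 11100
  gives 10100 and then 1111. For \<open>F1\<close>, the word 11111 is read both as 1111.1 and as
  1.1111, which leads to 11110 and back to the first case.\<close>

lemma cong_f1_f1_f1_f0_zero: "([F1, F1, F1, F0, x], [F1, F1, F1, F0]) \<in> cong"
proof -
  have zero: "([F1, F1, F1, F0, F0], [F1, F1, F1, F0]) \<in> cong"
  proof -
    have "([F1, F1, F1, F0, F0], [F1, F0, F1, F0, F0]) \<in> cong"
      using cong_append_left[OF cong_relations(3), of "[F1]"] by simp
    also note cong_relations(4)
    also note cong_relations(5)
    finally show ?thesis .
  qed
  moreover have "([F1, F1, F1, F0, F1], [F1, F1, F1, F0]) \<in> cong"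
  proof -
    have "([F1, F1, F1, F0, F1], [F1, F1, F1, F1, F1]) \<in> cong"
      using cong_append_right[OF cong_relations(5), of "[F1]"] by (simp add: generated_congruence.sym)
    also have "([F1, F1, F1, F1, F1], [F1, F1, F1, F1, F0]) \<in> cong"
      using cong_append_left[OF cong_relations(5), of "[F1]"] by simp
    also have "([F1, F1, F1, F1, F0], [F1, F1, F1, F0, F0]) \<in> cong"
      using cong_append_right[OF cong_relations(5), of "[F0]"] by simp
    also note zero
    finally show ?thesis .
  qed
  ultimately show ?thesis by (cases x) simp_all
qed

lemma cong_zero_rules:
  assumes "(l, r) \<in> set zero_rules"
  shows "(l @ t, r) \<in> cong"
proof -
  \<comment> \<open>Of the three right-hand sides, 0100 inherits absorption from its suffix
    00.\<close>
  have "([F0, F1, F0, F0, x], [F0, F1, F0, F0]) \<in> cong" for x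
    using cong_append_left[OF cong_f0_f0_zero, of "[F0, F1]"] by simp
  then have "(r @ t, r) \<in> cong"
    using assms cong_f0_f0_zero cong_f1_f1_f1_f0_zero
    by (intro cong_zero[of r t]; simp add: zero_rules_def; elim disjE; simp)
  \<comment> \<open>Only 10100 needs two relations, passing through 1111.\<close>
  moreover have "(l, r) \<in> cong"
    using assms cong_relations generated_congruence.trans[OF cong_relations(4,5)]
    by (simp add: zero_rules_def, elim disjE) (simp_all add: generated_congruence.refl)
  ultimately show ?thesis
    using cong_append_right generated_congruence.trans by blast
qed

section \<open>Left multiplication of normal forms by a generator\<close>

text \<open>If \<open>n\<close> is reduced, a factor to be rewritten must be a prefix of
  \<open>q # n\<close>, so only prefixes are tested. A zero rule replaces the whole word, and those
  with equal sides just cut off the tail; the last relation keeps what follows its eight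
  letters.\<close>

definition lmul :: "state \<Rightarrow> state list \<Rightarrow> state list" where
  "lmul q n = (let w = q # n in
     case find (\<lambda>(l, r). take (length l) w = l) zero_rules of
       Some (l, r) \<Rightarrow> r
     | None \<Rightarrow> if take 8 w = [F1, F0, F1, F0, F1, F0, F1, F0]
               then [F1, F0, F1, F0] @ drop 8 w else w)"

lemma cong_lmul: "(q # n, lmul q n) \<in> cong"
proof (cases "find (\<lambda>(l, r). take (length l) (q # n) = l) zero_rules")
  case None
  have "(q # n, [F1, F0, F1, F0] @ drop 8 (q # n)) \<in> cong"
    if "take 8 (q # n) = [F1, F0, F1, F0, F1, F0, F1, F0]"
    using cong_append_right[OF cong_relations(6), of "drop 8 (q # n)"]
      append_take_drop_id[of 8 "q # n"] that by (simp del: append_take_drop_id)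
  with None show ?thesis
    by (auto simp: lmul_def Let_def intro: generated_congruence.refl)
next
  case (Some p)
  then obtain l r where p: "p = (l, r)" "(l, r) \<in> set zero_rules" "take (length l) (q # n) = l"
    by (auto simp: find_Some_iff) (metis nth_mem)
  then have "(take (length l) (q # n) @ drop (length l) (q # n), r) \<in> cong"
    using cong_zero_rules by simp
  then show ?thesis
    using Some p(1) by (simp add: lmul_def Let_def)
qed

definition normal_form :: "state list \<Rightarrow> state list" where
  "normal_form w = foldr lmul w []"

lemma cong_normal_form: "w \<noteq> [] \<Longrightarrow> (w, normal_form w) \<in> cong"
proof (induction w rule: list_nonempty_induct)
  case (single q)
  then show ?case using cong_lmul by (simp add: normal_form_def)
next
  case (cons q w)
  then have "(q # w, q # normal_form w) \<in> cong"
    using cong_append_left[of w "normal_form w" "[q]"] by simp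
  also have "(q # normal_form w, lmul q (normal_form w)) \<in> cong"
    by (rule cong_lmul)
  finally show ?case by (simp add: normal_form_def)
qed

lemma ev_normal_form: "ev (normal_form w) = ev w"
proof (cases "w = []")
  case False
  then show ?thesis
    using word_map_eq_if_congruent[OF ev_relations cong_normal_form] by metis
qed (simp add: normal_form_def)

section \<open>Normal forms sorted by word length\<close>

text \<open>\<open>remdups\<close> keeps the lists short, so that levels can be evaluated without
  enumerating all words of length \<open>n\<close>.\<close>

primrec level :: "nat \<Rightarrow> state list list" where
  "level 0 = [[]]"
| "level (Suc n) = remdups (concat (map (\<lambda>w. [lmul F0 w, lmul F1 w]) (level n)))"

lemma set_level: "set (level n) = normal_form ` {w. length w = n}"
proof (induction n)
  case 0
  then show ?case by (simp add: normal_form_def)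
next
  case (Suc n)
  have "{w. length w = Suc n} = Cons F0 ` {w. length w = n} \<union> Cons F1 ` {w. length w = n}"
  proof (intro equalityI subsetI)
    fix w :: "state list" assume "w \<in> {w. length w = Suc n}"
    then obtain q v where "w = q # v" "length v = n"
      by (auto simp: length_Suc_conv)
    then show "w \<in> Cons F0 ` {w. length w = n} \<union> Cons F1 ` {w. length w = n}"
      by (cases q) auto
  qed auto
  moreover have "set (level (Suc n)) = lmul F0 ` set (level n) \<union> lmul F1 ` set (level n)"
    by auto
  ultimately show ?case
    using Suc by (simp add: image_Un image_image normal_form_def)
qed

lemma level_Suc_cong: "set (level m) = set (level n) \<Longrightarrow> set (level (Suc m)) = set (level (Suc n))"
  by simp

text \<open>Each level is determined by the set of its predecessor, so the single computed
  coincidence of levels 6 and 10 propagates. The period matches the four letters removed by the last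
  relation.\<close>

lemma level_periodic: "n \<ge> 6 \<Longrightarrow> set (level (n + 4)) = set (level n)"
proof (induction n rule: dec_induct)
  case base
  show ?case by code_simp
next
  case (step n)
  then show ?case using level_Suc_cong[of "n + 4" n] by simp
qed

text \<open>Levels 6 to 9 cover a full period; level 0 is left out because it holds only the empty
  word.\<close>

definition normal_forms :: "state list list" where
  "normal_forms = remdups (concat (map level [1..<10]))"

lemma level_subset_normal_forms:
  assumes "n \<ge> 1"
  shows "set (level n) \<subseteq> set normal_forms"
  using assms
proof (induction n rule: less_induct)
  case (less n)
  show ?case
  proof (cases "n < 10")
    case True
    with less.prems show ?thesis by (auto simp: normal_forms_def)
  next
    case False
    then show ?thesis
      using level_periodic[of "n - 4"] less.IH[of "n - 4"] by simp
  qed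
qed

lemma normal_form_in_normal_forms:
  assumes "w \<noteq> []"
  shows "normal_form w \<in> set normal_forms"
proof -
  have "normal_form w \<in> set (level (length w))"
    by (simp add: set_level)
  moreover have "length w \<ge> 1"
    using assms by (simp add: Suc_le_eq)
  ultimately show ?thesis
    using level_subset_normal_forms by blast
qed

section \<open>Separation by test words\<close>

lemma ev_inj_on_normal_forms: "inj_on ev (set normal_forms)"
proof -
  \<comment> \<open>The four outputs, taken together, already differ between any two normal forms,
    so a finite evaluation yields injectivity.\<close>
  have "distinct (map (\<lambda>w. map (ev w) [[X3, X1, X3, X2], [X1, X3, X3], [X2, X3], [X0, X3]])
      normal_forms)"
    by code_simp
  then have "inj_on (\<lambda>w. map (ev w) [[X3, X1, X3, X2], [X1, X3, X3], [X2, X3], [X0, X3]])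
      (set normal_forms)"
    by (simp only: distinct_map)
  then show ?thesis
    by (simp add: inj_on_def)
qed

text \<open>Separation plays the part of confluence: words with equal transformations have equal
  normal forms, and each word is congruent to its own.\<close>

lemma cong_iff_ev_eq:
  assumes "u \<in> words" "v \<in> words"
  shows "(u, v) \<in> cong \<longleftrightarrow> ev u = ev v"
proof
  assume "ev u = ev v"
  then have "normal_form u = normal_form v"
    using inj_onD[OF ev_inj_on_normal_forms] assms
    by (simp add: ev_normal_form normal_form_in_normal_forms)
  then have "(normal_form u, v) \<in> cong"
    using cong_normal_form[of v] assms by (simp add: generated_congruence.sym)
  with cong_normal_form[of u] show "(u, v) \<in> cong"
    using assms by (simp add: generated_congruence.trans)
next
  show "(u, v) \<in> cong \<Longrightarrow> ev u = ev v"
    using word_map_eq_if_congruent[OF ev_relations] .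
qed

section \<open>The growth function\<close>

lemma mealy_automaton_A2: "mealy_automaton A2"
proof -
  have "A2_trans x q \<in> {F0, F1}" for x q
    by (cases "A2_trans x q") simp_all
  then show ?thesis by (simp add: mealy_automaton_def A2_def)
qed

lemma growth_A2:
  assumes "n \<ge> 1"
  shows "growth A2 n = card (set (level n))"
proof -
  have "{qs. set qs \<subseteq> states A2 \<and> length qs = n} = {w. length w = n}"
    using state.exhaust by (auto simp: A2_def)
  then have "growth A2 n = card (ev ` {w. length w = n})"
    using growth_eq_card_word_map[OF mealy_automaton_A2] by simp
  also have "ev ` {w. length w = n} = ev ` set (level n)"
    by (simp add: set_level image_image ev_normal_form)
  also have "card \<dots> = card (set (level n))"
    using inj_on_subset[OF ev_inj_on_normal_forms level_subset_normal_forms[OF assms]]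
    by (rule card_image)
  finally show ?thesis .
qed

lemma card_level:
  "card (set (level 1)) = 2" "card (set (level 2)) = 4" "card (set (level 3)) = 7"
  "card (set (level 4)) = 8" "card (set (level 5)) = 9" "card (set (level 6)) = 8"
  "card (set (level 7)) = 9" "card (set (level 8)) = 8" "card (set (level 9)) = 9"
  by code_simp+

lemma card_level_eventually:
  assumes "n \<ge> 4"
  shows "card (set (level n)) = (if even n then 8 else 9)"
  using assms
proof (induction n rule: less_induct)
  case (less n)
  show ?case
  proof (cases "n < 10")
    case True
    with less.prems have "n \<in> {4, 5, 6, 7, 8, 9}" by auto
    then show ?thesis by (auto simp: card_level simp del: level.simps)
  next
    case False
    \<comment> \<open>A shift by the period 4 preserves parity, so the computed levels 4 to 9 leave
      just two values.\<close>
    then have "even (n - 4) \<longleftrightarrow> even n" by simp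
    with False show ?thesis
      using level_periodic[of "n - 4"] less.IH[of "n - 4"] by simp
  qed
qed

theorem theorem4p1:
  shows "has_presentation (automaton_semigroup A2) (\<circ>) (transformation A2) {F0, F1} A2_relations
    \<and> composite_function 2 (growth A2)
    \<and> (\<forall>n\<ge>2. growth A2 (2 * n) = 8 \<and> growth A2 (2 * n + 1) = 9)
    \<and> growth A2 1 = 2 \<and> growth A2 2 = 4 \<and> growth A2 3 = 7"
proof -
  have "automaton_semigroup A2 = generated_semigroup (transformation A2 ` {F0, F1})"
    by (simp add: automaton_semigroup_def transformations_def A2_def)
  then have presentation:
    "has_presentation (automaton_semigroup A2) (\<circ>) (transformation A2) {F0, F1} A2_relations"
    using has_presentation_word_map[OF A2_relations_words cong_iff_ev_eq] by simp
  have growth: "growth A2 (2 * n) = 8 \<and> growth A2 (2 * n + 1) = 9" if "n \<ge> 2" for n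
    using that by (simp add: growth_A2 card_level_eventually del: level.simps)
  \<comment> \<open>The summand \<open>0\<close> matches the residue \<open>i = 0\<close> in
    \<open>composite_function\<close>; 8 and 9 differ at every \<open>n \<ge> 2\<close>.\<close>
  then have "{2..} \<subseteq> {n. growth A2 (2 * n + 0) \<noteq> growth A2 (2 * n + 1)}"
    by auto
  then have "infinite {n. growth A2 (2 * n + 0) \<noteq> growth A2 (2 * n + 1)}"
    using infinite_Ici infinite_super by blast
  then have "composite_function 2 (growth A2)"
    unfolding composite_function_def by (intro conjI exI[of _ 0] exI[of _ 1]) simp_all
  with presentation growth show ?thesis
    using card_level(1-3) by (simp add: growth_A2 del: level.simps)
qed

end
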